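(* Let $\mathcal{D}=(V,\mathscr{E})$ be a directed acyclic graph on $V=\{1,\dots,p\}$ and let $\Gamma$ be a $\mathcal{D}$-partial matrix in $\mathrm{I}_{\mathcal{D}}$. If $\Gamma_{11}\neq 0$, then: (a) Almost everywhere (with respect to Lebesgue measure on $\mathrm{I}_{\mathcal{D}}$), there exist a unique lower triangular matrix $L\in\mathcal{L}_{\mathcal{D}}$ and a unique diagonal matrix $\Lambda\in\mathbb{R}^{p\times p}$ such that $\widehat{\Gamma}=L\Lambda L'$ is a completion of $\Gamma$. (b) The matrix $\widehat{\Gamma}$ (of part (a)) is the unique positive definite completion of $\Gamma$ in $\mathrm{P}_{\mathcal{D}}$ if and only if the diagonal entries of $\Lambda$ are all strictly positive.
   Context: $\mathcal{D}=(V,\mathscr{E})$ is a directed acyclic graph (DAG: a directed graph with no directed cycles of length greater than 1) on $V=\{1,\dots,p\}$, with vertices numbered so that $i\to j$ (i.e. $(i,j)\in\mathscr{E}$, $i\ne j$) implies $i>j$. By convention edge sets contain all loops $(i,i)$. $\mathrm{pa}(j)=\{i\neq j: i\to j\}$ and $\mathrm{pr}(j)=\{i: i>j,\ i\notin \mathrm{pa}(j)\}$. The undirected version of $\mathcal{D}$ is $\mathcal{G}=(V,\mathscr{V})$. A $\mathcal{D}$-partial matrix is a real symmetric function $\Gamma$ on $\{(i,j):\{i,j\}\in\mathscr{V}\}$ (including all diagonal positions), $\Gamma_{ij}=\Gamma_{ji}$. The set $\mathrm{I}_{\mathcal{D}}$ of all $\mathcal{D}$-partial matrices is a real linear space of dimension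 $|\mathscr{E}|$ (loops counted). A completion of $\Gamma$ is a symmetric real $p\times p$ matrix $T$ with $T_{ij}=\Gamma_{ij}$ for each $(i,j)\in\mathscr{E}$ (loops included); a completion in a set $\mathcal{M}$ of symmetric matrices is a completion $T\in\mathcal{M}$. $\mathcal{L}_{\mathcal{D}}$ is the set of all lower triangular $p\times p$ real matrices $L$ with unit diagonal entries such that $L_{ij}=0$ for each $(i,j)\notin\mathscr{E}$. $L'$ denotes the transpose. $\mathrm{PD}_{\mathcal{D}}$ is the set of $\Sigma\succ 0$ such that the Gaussian distribution $\mathrm{N}_p(0,\Sigma)$ obeys the directed local Markov property with respect to $\mathcal{D}$; equivalently, $\Sigma$ is symmetric positive definite and $\Sigma_{\mathrm{pr}(j),j}=\Sigma_{\mathrm{pr}(j),\mathrm{pa}(j)}(\Sigma_{\mathrm{pa}(j)})^{-1}\Sigma_{\mathrm{pa}(j),j}$ for all $j\in V$ (right-hand side $0$ if $\mathrm{pa}(j)=\emptyset$), where $\Sigma_{A,B}$ is the submatrix with rows in $A$ and columns in $B$ and $\Sigma_A=\Sigma_{A,A}$. $\mathrm{P}_{\mathcal{D}}=\{\Omega:\Omega^{-1}\in\mathrm{PD}_{\mathcal{D}}\}$. It is known that $\Omega\in\mathrm{P}_{\mathcal{D}}$ iff $\Omega=L\Lambda L'$ for some $L\in\mathcal{L}_{\mathcal{D}}$ and some diagonal $\Lambda$ with strictly positive diagonal entries, and this (modified Cholesky) decomposition is unique. *)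

theory Defs
  imports
    "HOL-Analysis.Analysis"
    "Jordan_Normal_Form.DL_Submatrix"
    "Jordan_Normal_Form.Gauss_Jordan_Elimination"
begin

text \<open>
  Matrices are indexed from 0, so the vertex set is \<open>{..<p}\<close>: the vertex written \<open>i\<close> in a
  numbering by \<open>1, \<dots>, p\<close> is \<open>i - 1\<close> here. The pair \<open>(i, j) \<in> E\<close> is the edge
  \<open>i \<rightarrow> j\<close>; edges point from larger to smaller vertices, and all loops belong to \<open>E\<close>.
\<close>

definition ordered_dag :: "nat \<Rightarrow> (nat \<times> nat) set \<Rightarrow> bool" where
  "ordered_dag p E \<longleftrightarrow>
     E \<subseteq> {..<p} \<times> {..<p} \<and>
     (\<forall>i<p. (i, i) \<in> E) \<and>
     acyclic (E - Id) \<and>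
     (\<forall>i j. (i, j) \<in> E \<and> i \<noteq> j \<longrightarrow> i > j)"

definition parents :: "(nat \<times> nat) set \<Rightarrow> nat \<Rightarrow> nat set" where
  "parents E j = {i. i \<noteq> j \<and> (i, j) \<in> E}"

definition predecessors :: "nat \<Rightarrow> (nat \<times> nat) set \<Rightarrow> nat \<Rightarrow> nat set" where
  "predecessors p E j = {i. i < p \<and> i > j \<and> i \<notin> parents E j}"

definition undirected :: "(nat \<times> nat) set \<Rightarrow> (nat \<times> nat) set" where
  "undirected E = E \<union> E\<inverse>"


text \<open>
  A partial matrix is a function on the positions in \<open>undirected E\<close>; as in
  \<open>HOL-Library.FuncSet\<close>, it takes the value \<open>undefined\<close> elsewhere.
\<close>

definition partial_matrices :: "(nat \<times> nat) set \<Rightarrow> (nat \<times> nat \<Rightarrow> real) set" where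
  "partial_matrices E =
     {\<Gamma> \<in> extensional (undirected E). \<forall>(i, j) \<in> undirected E. \<Gamma> (i, j) = \<Gamma> (j, i)}"

text \<open>
  Lebesgue measure on the space of partial matrices is transported along the linear
  isomorphism from \<open>\<real>\<^sup>E\<close> that extends a function on \<open>E\<close> symmetrically.
  It is taken on the Borel sets; completing it does not change which properties hold almost
  everywhere.
\<close>

definition sym_extension ::
    "(nat \<times> nat) set \<Rightarrow> (nat \<times> nat \<Rightarrow> real) \<Rightarrow> (nat \<times> nat \<Rightarrow> real)" where
  "sym_extension E f =
     (\<lambda>(i, j) \<in> undirected E. if (i, j) \<in> E then f (i, j) else f (j, i))"

definition lebesgue_partial :: "(nat \<times> nat) set \<Rightarrow> (nat \<times> nat \<Rightarrow> real) measure" where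
  "lebesgue_partial E =
     distr (Pi\<^sub>M E (\<lambda>_. lborel))
       (restrict_space (Pi\<^sub>M (undirected E) (\<lambda>_. borel)) (partial_matrices E))
       (sym_extension E)"


definition is_completion ::
    "nat \<Rightarrow> (nat \<times> nat) set \<Rightarrow> (nat \<times> nat \<Rightarrow> real) \<Rightarrow> real mat \<Rightarrow> bool" where
  "is_completion p E \<Gamma> T \<longleftrightarrow>
     T \<in> carrier_mat p p \<and> T\<^sup>T = T \<and> (\<forall>(i, j) \<in> E. T $$ (i, j) = \<Gamma> (i, j))"

definition unit_lower :: "nat \<Rightarrow> (nat \<times> nat) set \<Rightarrow> real mat set" where
  "unit_lower p E = {L \<in> carrier_mat p p.
     (\<forall>i<p. \<forall>j<p. i < j \<longrightarrow> L $$ (i, j) = 0) \<and>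
     (\<forall>i<p. L $$ (i, i) = 1) \<and>
     (\<forall>i<p. \<forall>j<p. (i, j) \<notin> E \<longrightarrow> L $$ (i, j) = 0)}"

definition cholesky_completion ::
    "nat \<Rightarrow> (nat \<times> nat) set \<Rightarrow> (nat \<times> nat \<Rightarrow> real) \<Rightarrow> real mat \<Rightarrow> real mat \<Rightarrow> bool" where
  "cholesky_completion p E \<Gamma> L \<Lambda> \<longleftrightarrow>
     L \<in> unit_lower p E \<and> \<Lambda> \<in> carrier_mat p p \<and> diagonal_mat \<Lambda> \<and>
     is_completion p E \<Gamma> (L * \<Lambda> * L\<^sup>T)"


definition positive_definite :: "nat \<Rightarrow> real mat \<Rightarrow> bool" where
  "positive_definite p A \<longleftrightarrow>
     A \<in> carrier_mat p p \<and> A\<^sup>T = A \<and>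
     (\<forall>v \<in> carrier_vec p. v \<noteq> 0\<^sub>v p \<longrightarrow> scalar_prod v (A *\<^sub>v v) > 0)"

text \<open>
  The covariance matrices of centred Gaussian distributions that obey the directed local Markov
  property, which for a positive definite covariance matrix is the equation below.
  For positive definite \<open>\<Sigma>\<close> the inverse always exists, so \<open>the\<close> is harmless. If
  \<open>parents E j\<close> is empty, the right-hand side is a product of matrices with inner
  dimension 0, hence the zero matrix.
\<close>

definition PD_dag :: "nat \<Rightarrow> (nat \<times> nat) set \<Rightarrow> real mat set" where
  "PD_dag p E = {\<Sigma>. positive_definite p \<Sigma> \<and>
     (\<forall>j<p. submatrix \<Sigma> (predecessors p E j) {j} =
        submatrix \<Sigma> (predecessors p E j) (parents E j)
        * the (mat_inverse (submatrix \<Sigma> (parents E j) (parents E j)))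
        * submatrix \<Sigma> (parents E j) {j})}"

definition P_dag :: "nat \<Rightarrow> (nat \<times> nat) set \<Rightarrow> real mat set" where
  "P_dag p E = {\<Omega> \<in> carrier_mat p p. \<exists>\<Sigma> \<in> PD_dag p E. mat_inverse \<Omega> = Some \<Sigma>}"

definition pd_completion_in_P ::
    "nat \<Rightarrow> (nat \<times> nat) set \<Rightarrow> (nat \<times> nat \<Rightarrow> real) \<Rightarrow> real mat \<Rightarrow> bool" where
  "pd_completion_in_P p E \<Gamma> T \<longleftrightarrow>
     is_completion p E \<Gamma> T \<and> positive_definite p T \<and> T \<in> P_dag p E"

end

theory Submission
  imports Defs "Jordan_Normal_Form.Determinant"
begin

text \<open>
  Comparing entries of \<open>L * \<Lambda> * L\<^sup>T\<close> with \<open>\<Gamma>\<close> column by column determines \<open>L\<close> and \<open>\<Lambda>\<close> recursively,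
  as long as the diagonal entries found on the way do not vanish. The \<open>j\<close>-th one is
  \<open>\<Gamma> (j, j)\<close> minus a quantity that depends only on entries of \<open>\<Gamma>\<close> in earlier columns, so by Fubini
  it is nonzero almost everywhere.

  For the second part, let \<open>\<Sigma>\<close> be the inverse of \<open>\<Omega>\<close>. The Markov property at \<open>j\<close> says that all the
  entries of column \<open>j\<close> of \<open>\<Sigma>\<close> below the diagonal are one fixed linear combination of the columns of
  \<open>parents E j\<close>. With the negated coefficients as column \<open>j\<close> of \<open>L\<close>, this says that \<open>\<Sigma> * L\<close> is upper
  triangular; then \<open>L\<^sup>T * \<Sigma> * L\<close> is upper triangular and symmetric, hence diagonal. So membership in
  \<open>P_dag\<close> amounts to a factorization \<open>L * \<Lambda> * L\<^sup>T\<close> with positive \<open>\<Lambda>\<close>, and uniqueness is inherited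
  from the first part.
\<close>

section \<open>The recursive solution of the completion equations\<close>

text \<open>
  \<open>chol E \<Gamma> i j\<close> is the entry \<open>(i, j)\<close> of \<open>L * \<Lambda>\<close>, in particular \<open>\<Lambda> $$ (j, j)\<close> for \<open>i = j\<close>; it is
  meaningful only if the earlier diagonal values are nonzero, since \<open>x / 0 = 0\<close>.
\<close>

function chol :: "(nat \<times> nat) set \<Rightarrow> (nat \<times> nat \<Rightarrow> real) \<Rightarrow> nat \<Rightarrow> nat \<Rightarrow> real" where
  "chol E \<Gamma> i j =
     (if (i, j) \<in> E then \<Gamma> (i, j) - (\<Sum>k<j. chol E \<Gamma> i k * chol E \<Gamma> j k / chol E \<Gamma> k k) else 0)"
  by pat_completeness auto
termination
  by (relation "Wellfounded.measure (\<lambda>(E, \<Gamma>, i, j). j)") auto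

declare chol.simps [simp del]

lemma chol_nonedge: "(i, j) \<notin> E \<Longrightarrow> chol E \<Gamma> i j = 0"
  by (simp add: chol.simps)

text \<open>The recursion for column \<open>j\<close> reads only edge entries in columns up to
  \<open>j\<close>. This allows changing the entry \<open>(j, j)\<close> without disturbing earlier
  columns, and passing from a function on \<open>E\<close> to its symmetric extension.\<close>

lemma chol_cong:
  assumes "\<And>a b. (a, b) \<in> E \<Longrightarrow> b \<le> j \<Longrightarrow> \<Gamma> (a, b) = \<Delta> (a, b)"
  shows "chol E \<Gamma> i j = chol E \<Delta> i j"
  using assms
proof (induction j arbitrary: i rule: less_induct)
  case (less j)
  have "chol E \<Gamma> a k = chol E \<Delta> a k" if "k < j" for a k
    using less that by auto
  then show ?case
    using less.prems by (auto simp: chol.simps[of E _ i j])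
qed

section \<open>Nonvanishing of the diagonal values almost everywhere\<close>

lemma borel_measurable_chol:
  assumes "\<And>e. e \<in> E \<Longrightarrow> (\<lambda>\<Gamma>. \<Gamma> e) \<in> borel_measurable M"
  shows "(\<lambda>\<Gamma>. chol E \<Gamma> i j) \<in> borel_measurable M"
proof (induction j arbitrary: i rule: less_induct)
  case (less j)
  show ?case
  proof (cases "(i, j) \<in> E")
    case True
    then show ?thesis
      using less assms
      by (subst chol.simps)
        (auto intro!: borel_measurable_diff borel_measurable_sum borel_measurable_divide
          borel_measurable_times)
  qed (simp add: chol_nonedge)
qed

text \<open>With all other coordinates fixed, the value is the coordinate at \<open>(j, j)\<close>
  minus a constant, so each line in that direction meets the zero set \<open>N\<close> in at most
  one point.\<close>

lemma AE_chol_diag_nonzero: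
  assumes "finite E" "(j, j) \<in> E"
  shows "AE \<Gamma> in Pi\<^sub>M E (\<lambda>_. lborel). chol E \<Gamma> j j \<noteq> 0"
proof -
  let ?M = "\<lambda>_ :: nat \<times> nat. lborel :: real measure"
  interpret product_sigma_finite ?M ..
  define F where "F = E - {(j, j)}"
  have E: "E = insert (j, j) F" and F: "finite F" "(j, j) \<notin> F"
    using assms by (auto simp: F_def)
  have meas: "(\<lambda>\<Gamma>. chol E \<Gamma> j j) \<in> borel_measurable (Pi\<^sub>M E ?M)"
    by (rule borel_measurable_chol) (auto intro: measurable_component_singleton)
  define N where "N = {\<Gamma> \<in> space (Pi\<^sub>M E ?M). chol E \<Gamma> j j = 0}"
  have N: "N \<in> sets (Pi\<^sub>M E ?M)"
    unfolding N_def using meas by measurable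
  have slice: "(\<integral>\<^sup>+y. indicator N (\<Gamma>((j, j) := y)) \<partial>lborel) = 0" for \<Gamma>
  proof -
    define s where "s = (\<Sum>k<j. chol E \<Gamma> j k * chol E \<Gamma> j k / chol E \<Gamma> k k)"
    have "chol E (\<Gamma>((j, j) := y)) j j = y - s" for y
    proof -
      have "chol E (\<Gamma>((j, j) := y)) a k = chol E \<Gamma> a k" if "k < j" for a k
        using that by (intro chol_cong) auto
      then show ?thesis
        using assms by (simp add: chol.simps[of E _ j j] s_def)
    qed
    \<comment> \<open>Only an inequality: \<open>N\<close> lies in the space of the product measure,
      and an arbitrary \<open>\<Gamma>\<close> may be outside it after the update.\<close>
    then have "(indicator N (\<Gamma>((j, j) := y)) :: ennreal) \<le> indicator {s} y" for y
      by (auto simp: N_def indicator_def)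
    then have "(\<integral>\<^sup>+y. indicator N (\<Gamma>((j, j) := y)) \<partial>lborel) \<le> (\<integral>\<^sup>+y. indicator {s} y \<partial>lborel)"
      by (intro nn_integral_mono) auto
    then show ?thesis by simp
  qed
  have "emeasure (Pi\<^sub>M E ?M) N = (\<integral>\<^sup>+\<Gamma>. indicator N \<Gamma> \<partial>Pi\<^sub>M E ?M)"
    using N by simp
  \<comment> \<open>Fubini with the coordinate \<open>(j, j)\<close> as the inner variable, so that
    \<open>slice\<close> applies.\<close>
  also have "\<dots> = (\<integral>\<^sup>+\<Gamma>. (\<integral>\<^sup>+y. indicator N (\<Gamma>((j, j) := y)) \<partial>lborel) \<partial>Pi\<^sub>M F ?M)"
    unfolding E using F N by (subst product_nn_integral_insert) (auto simp: E)
  finally have "emeasure (Pi\<^sub>M E ?M) N = 0"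
    by (simp add: slice)
  then show ?thesis
    using N by (auto intro!: AE_I[of _ _ N] simp: N_def)
qed

lemma ordered_dag_less: "ordered_dag p E \<Longrightarrow> (i, j) \<in> E \<Longrightarrow> i < p \<and> j < p \<and> j \<le> i"
  by (cases "i = j") (auto simp: ordered_dag_def less_imp_le)

lemma sym_extension_edge: "(i, j) \<in> E \<Longrightarrow> sym_extension E \<Gamma> (i, j) = \<Gamma> (i, j)"
  by (simp add: sym_extension_def undirected_def)

text \<open>Edges point downwards, so a position and its transpose both lie in \<open>E\<close> only
  on the diagonal; hence the case distinction in \<open>sym_extension\<close> yields a symmetric
  function.\<close>

lemma sym_extension_partial_matrices:
  assumes "ordered_dag p E"
  shows "sym_extension E \<Gamma> \<in> partial_matrices E"
proof -
  have "(i, j) \<in> E \<Longrightarrow> (j, i) \<in> E \<Longrightarrow> i = j" for i j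
    using ordered_dag_less[OF assms] by (meson antisym)
  then show ?thesis
    by (auto simp: partial_matrices_def sym_extension_def undirected_def)
qed

lemma measurable_sym_extension:
  assumes "ordered_dag p E"
  shows "sym_extension E \<in>
     Pi\<^sub>M E (\<lambda>_. lborel) \<rightarrow>\<^sub>M restrict_space (Pi\<^sub>M (undirected E) (\<lambda>_. borel)) (partial_matrices E)"
proof (rule measurable_restrict_space2)
  show "sym_extension E \<in> space (Pi\<^sub>M E (\<lambda>_. lborel)) \<rightarrow> partial_matrices E"
    using sym_extension_partial_matrices[OF assms] by auto
  show "sym_extension E \<in> Pi\<^sub>M E (\<lambda>_. lborel) \<rightarrow>\<^sub>M Pi\<^sub>M (undirected E) (\<lambda>_. borel)"
  proof (unfold sym_extension_def, rule measurable_restrict)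
    fix e assume e: "e \<in> undirected E"
    obtain i j where [simp]: "e = (i, j)" by (cases e)
    show "(\<lambda>\<Gamma>. case e of (i, j) \<Rightarrow> if (i, j) \<in> E then \<Gamma> (i, j) else \<Gamma> (j, i))
      \<in> borel_measurable (Pi\<^sub>M E (\<lambda>_. lborel))"
    proof (cases "(i, j) \<in> E")
      case True
      then show ?thesis by simp
    next
      case False
      then have "(j, i) \<in> E" using e by (auto simp: undirected_def)
      then show ?thesis using False by simp
    qed
  qed
qed

text \<open>The values of \<open>chol\<close> depend on edge entries alone, which
  \<open>sym_extension\<close> keeps, so the condition pulls back unchanged to the product measure
  on \<open>E\<close>; there it is a finite conjunction of almost sure events.\<close>

lemma AE_lebesgue_partial_chol_diag_nonzero:
  assumes dag: "ordered_dag p E"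
  shows "AE \<Gamma> in lebesgue_partial E. \<forall>j<p. chol E \<Gamma> j j \<noteq> 0"
proof -
  have fin: "finite E"
    using dag finite_subset[of E "{..<p} \<times> {..<p}"] by (auto simp: ordered_dag_def)
  let ?N = "restrict_space (Pi\<^sub>M (undirected E) (\<lambda>_. borel :: real measure)) (partial_matrices E)"
  have meas: "(\<lambda>\<Gamma>. chol E \<Gamma> i j) \<in> borel_measurable ?N" for i j
    by (rule borel_measurable_chol)
      (auto intro!: measurable_restrict_space1 measurable_component_singleton simp: undirected_def)
  have eq: "chol E (sym_extension E \<Gamma>) j j = chol E \<Gamma> j j" for \<Gamma> j
    by (rule chol_cong) (simp add: sym_extension_edge)
  have "{\<Gamma> \<in> space ?N. \<forall>j<p. chol E \<Gamma> j j \<noteq> 0} \<in> sets ?N"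
    using meas by measurable
  note iff = AE_distr_iff[OF measurable_sym_extension[OF dag] this, unfolded eq]
  have "AE \<Gamma> in Pi\<^sub>M E (\<lambda>_. lborel). \<forall>j\<in>{..<p}. chol E \<Gamma> j j \<noteq> 0"
    using fin dag by (intro AE_finite_allI AE_chol_diag_nonzero) (auto simp: ordered_dag_def)
  then show ?thesis
    by (simp only: lebesgue_partial_def iff Ball_def lessThan_iff)
qed

section \<open>Entrywise form of the factorization and the completion equations\<close>

lemma mult_diagonal_index:
  fixes X :: "real mat"
  assumes "X \<in> carrier_mat m p" "\<Lambda> \<in> carrier_mat p p" "diagonal_mat \<Lambda>" "i < m" "k < p"
  shows "(X * \<Lambda>) $$ (i, k) = X $$ (i, k) * \<Lambda> $$ (k, k)"
proof -
  have "(X * \<Lambda>) $$ (i, k) = (\<Sum>l\<in>{0..<p}. X $$ (i, l) * \<Lambda> $$ (l, k))"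
    using assms by (simp add: scalar_prod_def)
  also have "\<dots> = (\<Sum>l\<in>{0..<p}. if l = k then X $$ (i, k) * \<Lambda> $$ (k, k) else 0)"
    using assms by (intro sum.cong) (auto simp: diagonal_mat_def)
  finally show ?thesis using assms by simp
qed

lemma ldl_index:
  fixes L :: "real mat"
  assumes "L \<in> carrier_mat p p" "\<Lambda> \<in> carrier_mat p p" "diagonal_mat \<Lambda>" "i < p" "j < p"
  shows "(L * \<Lambda> * L\<^sup>T) $$ (i, j) = (\<Sum>k<p. L $$ (i, k) * \<Lambda> $$ (k, k) * L $$ (j, k))"
proof -
  have "(L * \<Lambda>) $$ (i, k) = L $$ (i, k) * \<Lambda> $$ (k, k)" if "k < p" for k
    using assms(1-4) that by (rule mult_diagonal_index)
  then show ?thesis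
    using assms by (simp add: scalar_prod_def lessThan_atLeast0 del: assoc_mult_mat)
qed

text \<open>Row \<open>j\<close> of \<open>L\<close> vanishes beyond the diagonal and has entry 1 on
  it, so the sum stops at \<open>k = j\<close> and its last term is the quantity to be solved
  for.\<close>

lemma ldl_index_unit_lower:
  assumes L: "L \<in> unit_lower p E" and "\<Lambda> \<in> carrier_mat p p" "diagonal_mat \<Lambda>" and ij: "i < p" "j < p"
  shows "(L * \<Lambda> * L\<^sup>T) $$ (i, j) =
    L $$ (i, j) * \<Lambda> $$ (j, j) + (\<Sum>k<j. L $$ (i, k) * \<Lambda> $$ (k, k) * L $$ (j, k))"
proof -
  let ?t = "\<lambda>k. L $$ (i, k) * \<Lambda> $$ (k, k) * L $$ (j, k)"
  have "(\<Sum>k<p. ?t k) = (\<Sum>k\<le>j. ?t k)"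
    using L ij by (intro sum.mono_neutral_right) (auto simp: unit_lower_def)
  also have "\<dots> = (\<Sum>k<j. ?t k) + ?t j"
    by (simp add: lessThan_Suc_atMost[symmetric])
  finally show ?thesis
    using assms ldl_index[of L p \<Lambda> i j] by (simp add: unit_lower_def)
qed

lemma ldl_symmetric:
  fixes L :: "real mat"
  assumes "L \<in> carrier_mat p p" "\<Lambda> \<in> carrier_mat p p" "diagonal_mat \<Lambda>"
  shows "(L * \<Lambda> * L\<^sup>T)\<^sup>T = L * \<Lambda> * L\<^sup>T"
proof (rule eq_matI)
  fix i j assume "i < dim_row (L * \<Lambda> * L\<^sup>T)" "j < dim_col (L * \<Lambda> * L\<^sup>T)"
  then have "i < p" "j < p" using assms by auto
  then show "(L * \<Lambda> * L\<^sup>T)\<^sup>T $$ (i, j) = (L * \<Lambda> * L\<^sup>T) $$ (i, j)"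
    using assms by (simp add: ldl_index ac_simps del: assoc_mult_mat index_mult_mat(1))
qed (use assms in auto)

text \<open>Symmetry of the product is automatic, which leaves one equation per edge; the equation
  at \<open>(i, j)\<close> involves columns up to \<open>j\<close> only.\<close>

lemma cholesky_completion_iff_equations:
  assumes dag: "ordered_dag p E"
  shows "cholesky_completion p E \<Gamma> L \<Lambda> \<longleftrightarrow>
    L \<in> unit_lower p E \<and> \<Lambda> \<in> carrier_mat p p \<and> diagonal_mat \<Lambda> \<and>
    (\<forall>(i, j) \<in> E. L $$ (i, j) * \<Lambda> $$ (j, j)
        + (\<Sum>k<j. L $$ (i, k) * \<Lambda> $$ (k, k) * L $$ (j, k)) = \<Gamma> (i, j))"
    (is "_ \<longleftrightarrow> _ \<and> _ \<and> _ \<and> ?eqs")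
proof -
  have "is_completion p E \<Gamma> (L * \<Lambda> * L\<^sup>T) \<longleftrightarrow> ?eqs"
    if "L \<in> unit_lower p E" "\<Lambda> \<in> carrier_mat p p" "diagonal_mat \<Lambda>"
  proof -
    have L: "L \<in> carrier_mat p p" using that by (simp add: unit_lower_def)
    have "(L * \<Lambda> * L\<^sup>T) $$ (i, j) = L $$ (i, j) * \<Lambda> $$ (j, j)
        + (\<Sum>k<j. L $$ (i, k) * \<Lambda> $$ (k, k) * L $$ (j, k))" if "(i, j) \<in> E" for i j
      using \<open>L \<in> unit_lower p E\<close> \<open>\<Lambda> \<in> carrier_mat p p\<close> \<open>diagonal_mat \<Lambda>\<close>
        ordered_dag_less[OF dag that] ldl_index_unit_lower by blast
    then show ?thesis
      using L that ldl_symmetric[OF L]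
      by (auto simp: is_completion_def simp del: assoc_mult_mat index_mult_mat(1))
  qed
  then show ?thesis
    unfolding cholesky_completion_def by blast
qed

text \<open>The equations form a triangular system. Nonzero diagonal values permit every division,
  so the system has exactly one solution, the one computed by \<open>chol\<close>.\<close>

lemma cholesky_completion_iff_chol:
  assumes dag: "ordered_dag p E" and nz: "\<forall>j<p. chol E \<Gamma> j j \<noteq> 0"
  shows "cholesky_completion p E \<Gamma> L \<Lambda> \<longleftrightarrow>
    L = mat p p (\<lambda>(i, j). chol E \<Gamma> i j / chol E \<Gamma> j j) \<and>
    \<Lambda> = mat p p (\<lambda>(i, j). if i = j then chol E \<Gamma> j j else 0)" (is "_ \<longleftrightarrow> L = ?L \<and> \<Lambda> = ?\<Lambda>")
proof
  assume *: "L = ?L \<and> \<Lambda> = ?\<Lambda>"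
  have "(i, j) \<notin> E" if "i < j" for i j
    using ordered_dag_less[OF dag, of i j] that by auto
  then have "L \<in> unit_lower p E"
    using * nz by (simp add: unit_lower_def chol_nonedge)
  moreover have "L $$ (i, j) * \<Lambda> $$ (j, j)
      + (\<Sum>k<j. L $$ (i, k) * \<Lambda> $$ (k, k) * L $$ (j, k)) = \<Gamma> (i, j)" if e: "(i, j) \<in> E" for i j
    using ordered_dag_less[OF dag e] nz e * by (simp add: chol.simps[of E \<Gamma> i j])
  ultimately show "cholesky_completion p E \<Gamma> L \<Lambda>"
    using * by (auto simp: cholesky_completion_iff_equations[OF dag] diagonal_mat_def)
next
  assume "cholesky_completion p E \<Gamma> L \<Lambda>"
  then have L: "L \<in> unit_lower p E" and \<Lambda>: "\<Lambda> \<in> carrier_mat p p" "diagonal_mat \<Lambda>"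
    and all: "\<forall>(i, j) \<in> E. L $$ (i, j) * \<Lambda> $$ (j, j)
      + (\<Sum>k<j. L $$ (i, k) * \<Lambda> $$ (k, k) * L $$ (j, k)) = \<Gamma> (i, j)"
    unfolding cholesky_completion_iff_equations[OF dag] by blast+
  have eqs: "L $$ (i, j) * \<Lambda> $$ (j, j) =
      \<Gamma> (i, j) - (\<Sum>k<j. L $$ (i, k) * \<Lambda> $$ (k, k) * L $$ (j, k))" if "(i, j) \<in> E" for i j
    using bspec[OF all that] by simp
  have L1: "L $$ (j, j) = 1" if "j < p" for j
    using L that by (simp add: unit_lower_def)
  have LE: "L $$ (i, j) = 0" if "i < p" "j < p" "(i, j) \<notin> E" for i j
    using L that by (simp add: unit_lower_def)
  \<comment> \<open>The equations determine this product directly. Taking \<open>i = j\<close> then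
    gives \<open>\<Lambda>\<close> because \<open>L\<close> has unit diagonal, and dividing gives
    \<open>L\<close>.\<close>
  have prod: "L $$ (i, j) * \<Lambda> $$ (j, j) = chol E \<Gamma> i j" if "i < p" "j < p" for i j
    using that
  proof (induction j arbitrary: i rule: less_induct)
    case (less j)
    show ?case
    proof (cases "(i, j) \<in> E")
      case True
      have "L $$ (i, k) * \<Lambda> $$ (k, k) * L $$ (j, k) =
          chol E \<Gamma> i k * chol E \<Gamma> j k / chol E \<Gamma> k k" if k: "k < j" for k
      proof -
        have "\<Lambda> $$ (k, k) = chol E \<Gamma> k k"
          using less.IH[OF k, of k] k less.prems L1[of k] by simp
        moreover have "L $$ (j, k) * \<Lambda> $$ (k, k) = chol E \<Gamma> j k"
          "L $$ (i, k) * \<Lambda> $$ (k, k) = chol E \<Gamma> i k"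
          using less.IH[OF k] k less.prems by auto
        ultimately show ?thesis
          using nz[rule_format, of k] k less.prems by (simp add: field_simps)
      qed
      then show ?thesis
        using True by (simp add: eqs chol.simps[of E \<Gamma> i j])
    qed (use less.prems LE in \<open>simp add: chol_nonedge\<close>)
  qed
  have diag: "\<Lambda> $$ (j, j) = chol E \<Gamma> j j" if "j < p" for j
    using prod[OF that that] L1[OF that] by simp
  have "L = ?L"
    using L nz prod diag by (intro eq_matI) (auto simp: unit_lower_def field_simps)
  moreover have "\<Lambda> = ?\<Lambda>"
    using \<Lambda> diag by (intro eq_matI) (auto simp: diagonal_mat_def)
  ultimately show "L = ?L \<and> \<Lambda> = ?\<Lambda>" ..
qed

section \<open>Positive definite matrices\<close>

lemma positive_definiteD:
  assumes "positive_definite p A"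
  shows "A \<in> carrier_mat p p" "A\<^sup>T = A"
    "\<And>v. v \<in> carrier_vec p \<Longrightarrow> v \<noteq> 0\<^sub>v p \<Longrightarrow> scalar_prod v (A *\<^sub>v v) > 0"
  using assms by (auto simp: positive_definite_def)

text \<open>The quadratic form of the congruent matrix at \<open>v\<close> is that of
  \<open>A\<close> at \<open>B *\<^sub>v v\<close>. Inverses, factorizations and principal
  submatrices are all treated as instances.\<close>

lemma positive_definite_congruence:
  assumes pd: "positive_definite p A" and B: "B \<in> carrier_mat p n"
    and inj: "\<And>v. v \<in> carrier_vec n \<Longrightarrow> B *\<^sub>v v = 0\<^sub>v p \<Longrightarrow> v = 0\<^sub>v n"
  shows "positive_definite n (B\<^sup>T * A * B)"
  unfolding positive_definite_def
proof (intro conjI ballI impI)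
  note A = positive_definiteD[OF pd]
  have carriers: "B\<^sup>T \<in> carrier_mat n p" "B\<^sup>T * A \<in> carrier_mat n p" "A * B \<in> carrier_mat p n"
    using A B by auto
  show "B\<^sup>T * A * B \<in> carrier_mat n n"
    using carriers B by simp
  have "(B\<^sup>T * A * B)\<^sup>T = B\<^sup>T * (B\<^sup>T * A)\<^sup>T"
    by (rule transpose_mult[OF carriers(2) B])
  also have "(B\<^sup>T * A)\<^sup>T = A * B"
    using transpose_mult[OF carriers(1) A(1)] A(2) by simp
  also have "B\<^sup>T * (A * B) = B\<^sup>T * A * B"
    using assoc_mult_mat[OF carriers(1) A(1) B] by simp
  finally show "(B\<^sup>T * A * B)\<^sup>T = B\<^sup>T * A * B" .
  fix v :: "real vec" assume v: "v \<in> carrier_vec n" "v \<noteq> 0\<^sub>v n"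
  have Bv: "B *\<^sub>v v \<in> carrier_vec p" using B v by simp
  have "(B\<^sup>T * A * B) *\<^sub>v v = B\<^sup>T *\<^sub>v (A *\<^sub>v (B *\<^sub>v v))"
    using assoc_mult_mat_vec[OF carriers(2) B v(1)] assoc_mult_mat_vec[OF carriers(1) A(1) Bv] by simp
  then have "scalar_prod v ((B\<^sup>T * A * B) *\<^sub>v v) = scalar_prod (B *\<^sub>v v) (A *\<^sub>v (B *\<^sub>v v))"
    using transpose_vec_mult_scalar[of "B\<^sup>T" n p "A *\<^sub>v (B *\<^sub>v v)" v] carriers v Bv A by simp
  then show "scalar_prod v ((B\<^sup>T * A * B) *\<^sub>v v) > 0"
    using A(3)[OF Bv] inj v by auto
qed

text \<open>Provides the injectivity premise of \<open>positive_definite_congruence\<close> when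
  \<open>B\<close> has a left inverse.\<close>

lemma left_inverse_inj:
  fixes B :: "real mat"
  assumes "C \<in> carrier_mat n p" "B \<in> carrier_mat p n" "C * B = 1\<^sub>m n" "v \<in> carrier_vec n" "B *\<^sub>v v = 0\<^sub>v p"
  shows "v = 0\<^sub>v n"
proof -
  have "v = C *\<^sub>v (B *\<^sub>v v)"
    using assoc_mult_mat_vec[OF assms(1,2,4)] assms by simp
  also have "\<dots> = 0\<^sub>v n"
    using assms by (intro eq_vecI) auto
  finally show ?thesis .
qed

lemma nonsingular_inverse:
  fixes A :: "real mat"
  assumes "A \<in> carrier_mat n n" "Determinant.det A \<noteq> 0"
  obtains B where "mat_inverse A = Some B" "B \<in> carrier_mat n n" "A * B = 1\<^sub>m n" "B * A = 1\<^sub>m n"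
proof (cases "mat_inverse A")
  case None
  then show ?thesis
    \<comment> \<open>Both facts concern units of the ring record of matrices; \<open>()\<close>
      fills its extension slot so that they refer to the same ring.\<close>
    using mat_inverse(1)[OF assms(1) None, of "()"] det_non_zero_imp_unit[OF assms, of "()"] by simp
next
  case (Some B)
  then show ?thesis
    using mat_inverse(2)[OF assms(1) Some] that by simp
qed

text \<open>A one-sided inverse suffices, since it already forces a nonzero determinant. This turns
  statements about \<open>mat_inverse\<close> into product equations and gives uniqueness of
  inverses.\<close>

lemma mat_inverse_eq_Some_iff:
  fixes A :: "real mat"
  assumes A: "A \<in> carrier_mat n n" and B: "B \<in> carrier_mat n n"
  shows "mat_inverse A = Some B \<longleftrightarrow> A * B = 1\<^sub>m n"
proof
  assume AB: "A * B = 1\<^sub>m n"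
  have "Determinant.det A \<noteq> 0"
    using AB det_mult[OF A B] by auto
  then obtain C where C: "mat_inverse A = Some C" "C \<in> carrier_mat n n" "C * A = 1\<^sub>m n"
    using nonsingular_inverse[OF A] by blast
  have "C = C * (A * B)"
    using AB C by simp
  also have "\<dots> = B"
    using assoc_mult_mat[OF C(2) A B] C(3) B by simp
  finally show "mat_inverse A = Some B" using C by simp
qed (use mat_inverse(2)[OF A] in blast)

lemma positive_definite_inverse:
  assumes pd: "positive_definite n A"
  obtains B where "mat_inverse A = Some B" "A * B = 1\<^sub>m n" "B * A = 1\<^sub>m n" "positive_definite n B"
proof -
  note A = positive_definiteD[OF pd]
  have "Determinant.det A \<noteq> 0"
    using A by (fastforce simp: det_0_iff_vec_prod_zero_field[OF A(1)])
  then obtain B where B: "mat_inverse A = Some B" "B \<in> carrier_mat n n" "A * B = 1\<^sub>m n" "B * A = 1\<^sub>m n"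
    using nonsingular_inverse[OF A(1)] by blast
  have BtA: "B\<^sup>T * A = 1\<^sub>m n"
    using transpose_mult[OF A(1) B(2)] A(2) B(3) by simp
  \<comment> \<open>The congruence of \<open>A\<close> by its own inverse is that inverse, by
    \<open>BtA\<close>.\<close>
  have "positive_definite n (B\<^sup>T * A * B)"
    by (rule positive_definite_congruence[OF pd B(2)]) (rule left_inverse_inj[OF A(1) B(2) B(3)])
  then have "positive_definite n B"
    using BtA B(2) by simp
  with B that show ?thesis by blast
qed

lemma positive_definite_diag_pos:
  assumes "positive_definite n A" "i < n"
  shows "A $$ (i, i) > 0"
proof -
  note A = positive_definiteD[OF assms(1)]
  have "scalar_prod (unit_vec n i) (A *\<^sub>v unit_vec n i) = A $$ (i, i)"
    using assms(2) A(1) by (subst scalar_prod_left_unit[of _ n]) auto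
  then show ?thesis
    using A(3)[of "unit_vec n i"] assms(2) by simp
qed

lemma positive_definite_diagonal_iff:
  assumes \<Lambda>: "\<Lambda> \<in> carrier_mat n n" "diagonal_mat \<Lambda>"
  shows "positive_definite n \<Lambda> \<longleftrightarrow> (\<forall>i<n. \<Lambda> $$ (i, i) > 0)"
proof (intro iffI allI impI)
  assume pos: "\<forall>i<n. \<Lambda> $$ (i, i) > 0"
  show "positive_definite n \<Lambda>"
    unfolding positive_definite_def
  proof (intro conjI ballI impI)
    show "\<Lambda>\<^sup>T = \<Lambda>"
    proof (rule eq_matI)
      fix i j assume "i < dim_row \<Lambda>" "j < dim_col \<Lambda>"
      then show "\<Lambda>\<^sup>T $$ (i, j) = \<Lambda> $$ (i, j)"
        using \<Lambda> by (cases "i = j") (auto simp: diagonal_mat_def)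
    qed (use \<Lambda> in auto)
    fix v :: "real vec" assume v: "v \<in> carrier_vec n" "v \<noteq> 0\<^sub>v n"
    have entry: "vec_index (\<Lambda> *\<^sub>v v) i = \<Lambda> $$ (i, i) * vec_index v i" if "i < n" for i
    proof -
      have "vec_index (\<Lambda> *\<^sub>v v) i = (\<Sum>k\<in>{0..<n}. \<Lambda> $$ (i, k) * vec_index v k)"
        using \<Lambda> v that by (simp add: scalar_prod_def)
      also have "\<dots> = (\<Sum>k\<in>{0..<n}. if k = i then \<Lambda> $$ (i, i) * vec_index v i else 0)"
        using \<Lambda> that by (intro sum.cong) (auto simp: diagonal_mat_def)
      finally show ?thesis using that by simp
    qed
    have "scalar_prod v (\<Lambda> *\<^sub>v v) = (\<Sum>i\<in>{0..<n}. \<Lambda> $$ (i, i) * (vec_index v i)\<^sup>2)"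
      using \<Lambda> v entry by (simp add: scalar_prod_def power2_eq_square ac_simps del: index_mult_mat_vec)
    moreover obtain i where "i < n" "vec_index v i \<noteq> 0"
      using v by (metis carrier_vecD eq_vecI index_zero_vec)
    ultimately show "scalar_prod v (\<Lambda> *\<^sub>v v) > 0"
      using pos by (auto intro!: sum_pos2[of _ i] simp: less_imp_le)
  qed (rule \<Lambda>)
qed (rule positive_definite_diag_pos)

lemma unit_lower_inverse:
  assumes L: "L \<in> unit_lower p E"
  obtains M where "M \<in> carrier_mat p p" "L * M = 1\<^sub>m p" "M * L = 1\<^sub>m p"
proof -
  have carrier: "L \<in> carrier_mat p p" using L by (simp add: unit_lower_def)
  have "Determinant.det L = prod_list (diag_mat L)"
    using L carrier by (intro det_lower_triangular) (auto simp: unit_lower_def)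
  also have "diag_mat L = map (\<lambda>_. 1) [0..<p]"
    using L by (auto simp: diag_mat_def unit_lower_def)
  finally have "Determinant.det L \<noteq> 0" by (auto simp: prod_list_zero_iff)
  then show ?thesis
    using nonsingular_inverse[OF carrier] that by blast
qed

text \<open>The two matrices are congruent: \<open>L\<^sup>T\<close> carries
  \<open>\<Lambda>\<close> to the product, and the transpose of the inverse \<open>M\<close> of
  \<open>L\<close> carries it back.\<close>

lemma positive_definite_ldl_iff:
  assumes L: "L \<in> unit_lower p E" and \<Lambda>: "\<Lambda> \<in> carrier_mat p p" "diagonal_mat \<Lambda>"
  shows "positive_definite p (L * \<Lambda> * L\<^sup>T) \<longleftrightarrow> (\<forall>i<p. \<Lambda> $$ (i, i) > 0)"
proof -
  have Lc: "L \<in> carrier_mat p p" using L by (simp add: unit_lower_def)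
  obtain M where M: "M \<in> carrier_mat p p" "L * M = 1\<^sub>m p" "M * L = 1\<^sub>m p"
    using unit_lower_inverse[OF L] .
  have MT: "M\<^sup>T * L\<^sup>T = 1\<^sub>m p" "L\<^sup>T * M\<^sup>T = 1\<^sub>m p"
    using transpose_mult[OF Lc M(1)] transpose_mult[OF M(1) Lc] unfolding M(2,3) transpose_one
    by metis+
  have carriers: "L\<^sup>T \<in> carrier_mat p p" "M\<^sup>T \<in> carrier_mat p p" using Lc M by auto
  \<comment> \<open>The double transpose matches the shape \<open>B\<^sup>T * A * B\<close> with
    \<open>B = L\<^sup>T\<close>.\<close>
  have "positive_definite p (L\<^sup>T\<^sup>T * \<Lambda> * L\<^sup>T)" if "positive_definite p \<Lambda>"
    by (rule positive_definite_congruence[OF that carriers(1)])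
      (rule left_inverse_inj[OF carriers(2,1) MT(1)])
  moreover have "positive_definite p \<Lambda>" if pd: "positive_definite p (L * \<Lambda> * L\<^sup>T)"
  proof -
    have "positive_definite p (M\<^sup>T\<^sup>T * (L * \<Lambda> * L\<^sup>T) * M\<^sup>T)"
      by (rule positive_definite_congruence[OF pd carriers(2)])
        (rule left_inverse_inj[OF carriers(1,2) MT(2)])
    also have "M\<^sup>T\<^sup>T * (L * \<Lambda> * L\<^sup>T) * M\<^sup>T = M * (L * (\<Lambda> * (L\<^sup>T * M\<^sup>T)))"
      using carriers Lc M(1) \<Lambda>(1) by (simp add: assoc_mult_mat[of _ p p _ p _ p])
    also have "\<dots> = M * L * \<Lambda>"
      using carriers Lc M(1) \<Lambda>(1) MT by (simp add: assoc_mult_mat[of _ p p _ p _ p])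
    also have "\<dots> = \<Lambda>" using M \<Lambda> by simp
    finally show ?thesis .
  qed
  ultimately show ?thesis
    using positive_definite_diagonal_iff[OF \<Lambda>] by auto
qed

section \<open>Submatrices and regression on a set of columns\<close>

lemma bij_betw_pick:
  assumes "finite A"
  shows "bij_betw (pick A) {..<card A} A"
\<comment> \<open>The inverse of \<open>pick\<close> sends an element to its rank, the number of
  smaller elements of \<open>A\<close>.\<close>
proof (rule bij_betw_byWitness[where f' = "\<lambda>i. card {a \<in> A. a < i}"])
  show "(\<lambda>i. card {a \<in> A. a < i}) ` A \<subseteq> {..<card A}"
    using assms by (auto intro!: psubset_card_mono)
qed (auto simp: card_pick_le pick_card_in_set pick_in_set_le)

lemma submatrix_eq_mat:
  assumes "A \<in> carrier_mat p p" "I \<subseteq> {..<p}" "J \<subseteq> {..<p}"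
  shows "submatrix A I J = mat (card I) (card J) (\<lambda>(a, b). A $$ (pick I a, pick J b))"
proof -
  have "{i. i < p \<and> i \<in> I} = I" "{i. i < p \<and> i \<in> J} = J" using assms by auto
  then show ?thesis using assms by (simp add: submatrix_def)
qed

text \<open>Reindexing along \<open>pick\<close> replaces positions inside submatrices by vertices,
  so later arguments can use plain sums over \<open>J\<close>.\<close>

lemma submatrix_column_eq_iff:
  fixes A :: "real mat"
  assumes A: "A \<in> carrier_mat p p" and I: "I \<subseteq> {..<p}" and J: "J \<subseteq> {..<p}" and j: "j < p"
  shows "submatrix A I {j} = submatrix A I J * mat (card J) 1 (\<lambda>(a, _). x (pick J a)) \<longleftrightarrow>
    (\<forall>i\<in>I. A $$ (i, j) = (\<Sum>k\<in>J. A $$ (i, k) * x k))"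
proof -
  have fin: "finite I" "finite J" using I J finite_subset by auto
  have "pick {j} 0 = j" using pick_in_set_le[of 0 "{j}"] by simp
  then have lhs: "submatrix A I {j} = mat (card I) 1 (\<lambda>(a, _). A $$ (pick I a, j))"
    using submatrix_eq_mat[OF A I, of "{j}"] j by (auto intro!: eq_matI)
  have rhs: "submatrix A I J * mat (card J) 1 (\<lambda>(a, _). x (pick J a)) =
      mat (card I) 1 (\<lambda>(a, _). \<Sum>k\<in>J. A $$ (pick I a, k) * x k)"
  proof (rule eq_matI)
    fix a b
    assume ab: "a < dim_row (mat (card I) 1 (\<lambda>(a, _). \<Sum>k\<in>J. A $$ (pick I a, k) * x k))"
      "b < dim_col (mat (card I) 1 (\<lambda>(a, _). \<Sum>k\<in>J. A $$ (pick I a, k) * x k))"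
    have "(\<Sum>c\<in>{0..<card J}. A $$ (pick I a, pick J c) * x (pick J c)) =
        (\<Sum>k\<in>J. A $$ (pick I a, k) * x k)"
      using bij_betw_pick[OF fin(2)]
      by (subst sum.reindex_bij_betw[symmetric, of "pick J" "{..<card J}"]) (auto simp: lessThan_atLeast0)
    with ab show "(submatrix A I J * mat (card J) 1 (\<lambda>(a, _). x (pick J a))) $$ (a, b) =
        mat (card I) 1 (\<lambda>(a, _). \<Sum>k\<in>J. A $$ (pick I a, k) * x k) $$ (a, b)"
      by (simp add: submatrix_eq_mat[OF A I J] scalar_prod_def)
  qed (simp_all add: submatrix_eq_mat[OF A I J])
  have "submatrix A I {j} = submatrix A I J * mat (card J) 1 (\<lambda>(a, _). x (pick J a)) \<longleftrightarrow>
      (\<forall>a<card I. A $$ (pick I a, j) = (\<Sum>k\<in>J. A $$ (pick I a, k) * x k))"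
    unfolding lhs rhs by (auto simp: mat_eq_iff)
  also have "\<dots> \<longleftrightarrow> (\<forall>i \<in> pick I ` {..<card I}. A $$ (i, j) = (\<Sum>k\<in>J. A $$ (i, k) * x k))"
    by auto
  also have "pick I ` {..<card I} = I"
    using bij_betw_pick[OF fin(1)] by (simp add: bij_betw_def)
  finally show ?thesis .
qed

text \<open>A principal submatrix is the congruence by the 0-1 matrix \<open>B\<close> whose columns
  are the unit vectors selected by \<open>I\<close>.\<close>

lemma positive_definite_submatrix:
  assumes pd: "positive_definite p A" and I: "I \<subseteq> {..<p}"
  shows "positive_definite (card I) (submatrix A I I)"
proof -
  note A = positive_definiteD[OF pd]
  have fin: "finite I" using I finite_subset by auto
  have pick: "pick I a < p" if "a < card I" for a
    using pick_in_set_le[OF that] I by auto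
  have pick_eq: "pick I a = pick I b \<longleftrightarrow> a = b" if "a < card I" "b < card I" for a b
    using bij_betw_pick[OF fin] that by (auto simp: bij_betw_def inj_on_def)
  define B :: "real mat" where "B = mat p (card I) (\<lambda>(i, a). if i = pick I a then 1 else 0)"
  have B: "B \<in> carrier_mat p (card I)" by (simp add: B_def)
  have "positive_definite (card I) (B\<^sup>T * A * B)"
  proof (rule positive_definite_congruence[OF pd B])
    fix v :: "real vec" assume v: "v \<in> carrier_vec (card I)" "B *\<^sub>v v = 0\<^sub>v p"
    have "vec_index v a = 0" if a: "a < card I" for a
    proof -
      have "vec_index (B *\<^sub>v v) (pick I a) =
          (\<Sum>b\<in>{0..<card I}. (if a = b then 1 else 0) * vec_index v b)"
        using v(1) a pick by (simp add: B_def scalar_prod_def pick_eq)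
      also have "\<dots> = (\<Sum>b\<in>{0..<card I}. if b = a then vec_index v a else 0)"
        by (intro sum.cong) auto
      finally have "vec_index (B *\<^sub>v v) (pick I a) = vec_index v a"
        using a by simp
      then show ?thesis using v(2) a pick by simp
    qed
    then show "v = 0\<^sub>v (card I)" using v(1) by (intro eq_vecI) auto
  qed
  also have "B\<^sup>T * A * B = submatrix A I I"
  proof (rule eq_matI)
    fix a b assume "a < dim_row (submatrix A I I)" "b < dim_col (submatrix A I I)"
    then have ab: "a < card I" "b < card I" by (simp_all add: submatrix_eq_mat[OF A(1) I I])
    have "(B\<^sup>T * A) $$ (a, i) = A $$ (pick I a, i)" if "i < p" for i
    proof -
      have "(B\<^sup>T * A) $$ (a, i) = (\<Sum>k\<in>{0..<p}. (if k = pick I a then 1 else 0) * A $$ (k, i))"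
        using A(1) ab that by (simp add: B_def scalar_prod_def)
      also have "\<dots> = (\<Sum>k\<in>{0..<p}. if k = pick I a then A $$ (pick I a, i) else 0)"
        by (intro sum.cong) auto
      finally have "(B\<^sup>T * A) $$ (a, i) = \<dots>" .
      then show ?thesis using pick[OF ab(1)] by simp
    qed
    moreover have "(B\<^sup>T * A * B) $$ (a, b) =
        (\<Sum>k\<in>{0..<p}. (B\<^sup>T * A) $$ (a, k) * (if k = pick I b then 1 else 0))"
      using A(1) ab
      by (simp add: scalar_prod_def B_def del: assoc_mult_mat)
    ultimately have "(B\<^sup>T * A * B) $$ (a, b) =
        (\<Sum>k\<in>{0..<p}. A $$ (pick I a, k) * (if k = pick I b then 1 else 0))"
      by simp
    also have "\<dots> = (\<Sum>k\<in>{0..<p}. if k = pick I b then A $$ (pick I a, pick I b) else 0)"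
      by (intro sum.cong) auto
    finally have "(B\<^sup>T * A * B) $$ (a, b) = \<dots>" .
    then show "(B\<^sup>T * A * B) $$ (a, b) = submatrix A I I $$ (a, b)"
      using pick[OF ab(2)] ab by (simp add: submatrix_eq_mat[OF A(1) I I])
  qed (simp_all add: B_def submatrix_eq_mat[OF A(1) I I])
  finally show ?thesis .
qed

text \<open>Eliminates the inverse. The rows in \<open>J\<close> form an invertible system that
  forces the coefficients to be the inverse applied to column \<open>j\<close>; the rows in
  \<open>I\<close> then state the original equation.\<close>

lemma regression_equation_iff:
  assumes pd: "positive_definite p A" and I: "I \<subseteq> {..<p}" and J: "J \<subseteq> {..<p}" and j: "j < p"
  shows "submatrix A I {j} =
      submatrix A I J * the (mat_inverse (submatrix A J J)) * submatrix A J {j} \<longleftrightarrow>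
    (\<exists>x. \<forall>i\<in>J \<union> I. A $$ (i, j) = (\<Sum>k\<in>J. A $$ (i, k) * x k))"
proof -
  note A = positive_definiteD(1)[OF pd]
  let ?col = "\<lambda>x. mat (card J) 1 (\<lambda>(a, _). x (pick J a)) :: real mat"
  obtain N where N: "mat_inverse (submatrix A J J) = Some N" "submatrix A J J * N = 1\<^sub>m (card J)"
      "N * submatrix A J J = 1\<^sub>m (card J)" "positive_definite (card J) N"
    using positive_definite_inverse[OF positive_definite_submatrix[OF pd J]] .
  have carriers: "submatrix A J J \<in> carrier_mat (card J) (card J)" "N \<in> carrier_mat (card J) (card J)"
    "submatrix A J {j} \<in> carrier_mat (card J) 1" "submatrix A I J \<in> carrier_mat (card I) (card J)"
    using positive_definiteD(1)[OF N(4)] submatrix_eq_mat[OF A, of _ "{j}"] submatrix_eq_mat[OF A] I J j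
    by simp_all
  have solve: "submatrix A J {j} = submatrix A J J * X \<longleftrightarrow> X = N * submatrix A J {j}"
    if X: "X \<in> carrier_mat (card J) 1" for X
    using assoc_mult_mat[OF carriers(2,1) X] assoc_mult_mat[OF carriers(1,2,3)] N(2,3) X carriers(3)
    by auto
  have "submatrix A I {j} = submatrix A I J * the (mat_inverse (submatrix A J J)) * submatrix A J {j}
      \<longleftrightarrow> (\<exists>x. ?col x = N * submatrix A J {j} \<and> submatrix A I {j} = submatrix A I J * ?col x)"
  proof -
    let ?X = "N * submatrix A J {j}"
    \<comment> \<open>Any one-column matrix arises from coefficients on \<open>J\<close>: the vertex
      \<open>k\<close> receives the entry at its rank.\<close>
    have "?col (\<lambda>k. ?X $$ (card {a \<in> J. a < k}, 0)) = ?X"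
      using carriers by (intro eq_matI) (simp_all add: card_pick_le del: index_mult_mat(1))
    then have "\<exists>x. ?col x = ?X"
      by (rule exI[of "\<lambda>x. ?col x = ?X"])
    moreover have "submatrix A I J * the (mat_inverse (submatrix A J J)) * submatrix A J {j} =
        submatrix A I J * ?X"
      using assoc_mult_mat[OF carriers(4,2,3)] N(1) by simp
    ultimately show ?thesis by auto
  qed
  also have "\<dots> \<longleftrightarrow> (\<exists>x. submatrix A J {j} = submatrix A J J * ?col x \<and>
      submatrix A I {j} = submatrix A I J * ?col x)"
    using solve by simp
  also have "\<dots> \<longleftrightarrow> (\<exists>x. \<forall>i\<in>J \<union> I. A $$ (i, j) = (\<Sum>k\<in>J. A $$ (i, k) * x k))"
    using submatrix_column_eq_iff[OF A I J j] submatrix_column_eq_iff[OF A J J j] by (simp add: ball_Un)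
  finally show ?thesis .
qed

section \<open>The Markov property and the Cholesky factorization\<close>

text \<open>Parents and predecessors of \<open>j\<close> together are exactly the vertices after
  \<open>j\<close>, so the rows in \<open>regression_equation_iff\<close> are all those below the
  diagonal.\<close>

lemma PD_dag_iff:
  assumes dag: "ordered_dag p E"
  shows "\<Sigma> \<in> PD_dag p E \<longleftrightarrow> positive_definite p \<Sigma> \<and>
    (\<forall>j<p. \<exists>x. \<forall>i. j < i \<and> i < p \<longrightarrow> \<Sigma> $$ (i, j) = (\<Sum>k\<in>parents E j. \<Sigma> $$ (i, k) * x k))"
proof -
  have sub: "parents E j \<subseteq> {..<p}" "predecessors p E j \<subseteq> {..<p}" for j
    using ordered_dag_less[OF dag] by (auto simp: parents_def predecessors_def)
  have un: "i \<in> parents E j \<union> predecessors p E j \<longleftrightarrow> j < i \<and> i < p" for i j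
    using ordered_dag_less[OF dag, of i j] by (auto simp: parents_def predecessors_def)
  show ?thesis
    unfolding PD_dag_def using regression_equation_iff[OF _ sub(2,1)]
    by (auto simp only: mem_Collect_eq Ball_def un)
qed

text \<open>Column \<open>j\<close> of \<open>L\<close> is supported on \<open>j\<close> and its
  parents. Hence a zero entry of \<open>A * L\<close> expresses a regression with coefficients
  \<open>- L $$ (k, j)\<close>.\<close>

lemma mult_unit_lower_index:
  assumes dag: "ordered_dag p E" and L: "L \<in> unit_lower p E" and A: "A \<in> carrier_mat m p"
    and ij: "i < m" "j < p"
  shows "(A * L) $$ (i, j) = A $$ (i, j) + (\<Sum>k\<in>parents E j. A $$ (i, k) * L $$ (k, j))"
proof -
  have Lc: "L \<in> carrier_mat p p" using L by (simp add: unit_lower_def)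
  have sub: "insert j (parents E j) \<subseteq> {..<p}"
    using ordered_dag_less[OF dag] ij by (auto simp: parents_def)
  have "(A * L) $$ (i, j) = (\<Sum>k<p. A $$ (i, k) * L $$ (k, j))"
    using Lc A ij by (simp add: scalar_prod_def lessThan_atLeast0)
  also have "\<dots> = (\<Sum>k\<in>insert j (parents E j). A $$ (i, k) * L $$ (k, j))"
    using sub L ij by (intro sum.mono_neutral_right) (auto simp: unit_lower_def parents_def)
  also have "\<dots> = A $$ (i, j) + (\<Sum>k\<in>parents E j. A $$ (i, k) * L $$ (k, j))"
    using finite_subset[OF sub] L ij by (subst sum.insert) (auto simp: unit_lower_def parents_def)
  finally show ?thesis .
qed

text \<open>In row \<open>i\<close> of the product, terms with \<open>k < j\<close> vanish by
  induction and terms with \<open>k > j\<close> because \<open>L\<close> is lower triangular; only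
  \<open>W $$ (i, j)\<close> remains.\<close>

lemma upper_triangular_cancel_unit_lower_transpose:
  assumes L: "L \<in> unit_lower p E" and W: "W \<in> carrier_mat p p"
    and zero: "\<And>i j. j < i \<Longrightarrow> i < p \<Longrightarrow> (W * L\<^sup>T) $$ (i, j) = 0"
    and "j < i" "i < p"
  shows "W $$ (i, j) = 0"
  using assms(4)
proof (induction j rule: less_induct)
  case (less j)
  have Lc: "L \<in> carrier_mat p p" using L by (simp add: unit_lower_def)
  have "(W * L\<^sup>T) $$ (i, j) = (\<Sum>k<p. W $$ (i, k) * L $$ (j, k))"
    using Lc W less.prems \<open>i < p\<close> by (simp add: scalar_prod_def lessThan_atLeast0)
  also have "\<dots> = (\<Sum>k\<in>{j}. W $$ (i, k) * L $$ (j, k))"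
  proof (rule sum.mono_neutral_right)
    show "\<forall>k\<in>{..<p} - {j}. W $$ (i, k) * L $$ (j, k) = 0"
    proof
      fix k assume "k \<in> {..<p} - {j}"
      then consider "k < j" | "j < k" "k < p" by fastforce
      then show "W $$ (i, k) * L $$ (j, k) = 0"
        using less \<open>i < p\<close> L by cases (auto simp: unit_lower_def)
    qed
  qed (use less.prems \<open>i < p\<close> in auto)
  also have "\<dots> = W $$ (i, j)"
    using L less.prems \<open>i < p\<close> by (simp add: unit_lower_def)
  finally show ?case
    using zero less.prems \<open>i < p\<close> by simp
qed

text \<open>The identity \<open>\<Sigma> * L * \<Lambda> * L\<^sup>T\<close> is upper triangular.
  Cancelling \<open>L\<^sup>T\<close> and then the nonzero diagonal of \<open>\<Lambda>\<close>
  leaves \<open>\<Sigma> * L\<close> upper triangular, which is the Markov property with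
  coefficients read off from \<open>- L\<close>.\<close>

lemma ldl_in_P_dag:
  assumes dag: "ordered_dag p E" and L: "L \<in> unit_lower p E"
    and \<Lambda>: "\<Lambda> \<in> carrier_mat p p" "diagonal_mat \<Lambda>" and pos: "\<forall>i<p. \<Lambda> $$ (i, i) > 0"
  shows "L * \<Lambda> * L\<^sup>T \<in> P_dag p E"
proof -
  have Lc: "L \<in> carrier_mat p p" using L by (simp add: unit_lower_def)
  let ?\<Omega> = "L * \<Lambda> * L\<^sup>T"
  have pd: "positive_definite p ?\<Omega>"
    using positive_definite_ldl_iff[OF L \<Lambda>] pos by simp
  obtain \<Sigma> where \<Sigma>: "mat_inverse ?\<Omega> = Some \<Sigma>" "\<Sigma> * ?\<Omega> = 1\<^sub>m p" "positive_definite p \<Sigma>"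
    using positive_definite_inverse[OF pd] .
  have \<Sigma>c: "\<Sigma> \<in> carrier_mat p p" by (rule positive_definiteD(1)[OF \<Sigma>(3)])
  have "\<Sigma> * L * \<Lambda> * L\<^sup>T = 1\<^sub>m p"
    using \<Sigma>(2) \<Sigma>c Lc \<Lambda>(1) by (simp add: assoc_mult_mat[of _ p p _ p _ p])
  then have W: "(\<Sigma> * L * \<Lambda>) $$ (i, j) = 0" if "j < i" "i < p" for i j
    using that \<Sigma>c Lc \<Lambda>(1)
    by (intro upper_triangular_cancel_unit_lower_transpose[OF L, of "\<Sigma> * L * \<Lambda>"]) auto
  have "\<Sigma> $$ (i, j) = (\<Sum>k\<in>parents E j. \<Sigma> $$ (i, k) * - L $$ (k, j))" if "j < i" "i < p" for i j
  proof -
    have "(\<Sigma> * L) $$ (i, j) * \<Lambda> $$ (j, j) = 0"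
      using W[OF that] mult_diagonal_index[of "\<Sigma> * L" p p \<Lambda> i j] \<Sigma>c Lc \<Lambda> that by simp
    moreover have "\<Lambda> $$ (j, j) \<noteq> 0"
      using pos[rule_format, of j] that by simp
    ultimately have "(\<Sigma> * L) $$ (i, j) = 0"
      by simp
    then show ?thesis
      using mult_unit_lower_index[OF dag L \<Sigma>c, of i j] that by (simp add: sum_negf)
  qed
  then have "\<forall>j<p. \<exists>x. \<forall>i. j < i \<and> i < p \<longrightarrow> \<Sigma> $$ (i, j) = (\<Sum>k\<in>parents E j. \<Sigma> $$ (i, k) * x k)"
    by (auto intro!: exI[of _ "\<lambda>k. - L $$ (k, j)" for j])
  then have "\<Sigma> \<in> PD_dag p E"
    unfolding PD_dag_iff[OF dag] using \<Sigma>(3) by blast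
  then show ?thesis
    using \<Sigma>(1) positive_definiteD(1)[OF pd] unfolding P_dag_def by blast
qed

text \<open>The converse construction: the regression coefficients give \<open>L\<close>, and
  inverting the diagonal matrix \<open>D\<close> gives \<open>\<Lambda>\<close>.\<close>

lemma P_dag_ldlE:
  assumes dag: "ordered_dag p E" and \<Omega>: "\<Omega> \<in> P_dag p E"
  obtains L \<Lambda> where "L \<in> unit_lower p E" "\<Lambda> \<in> carrier_mat p p" "diagonal_mat \<Lambda>"
    "\<Omega> = L * \<Lambda> * L\<^sup>T"
proof -
  obtain \<Sigma> where \<Sigma>: "\<Sigma> \<in> PD_dag p E" "mat_inverse \<Omega> = Some \<Sigma>" and \<Omega>c: "\<Omega> \<in> carrier_mat p p"
    using \<Omega> by (auto simp: P_dag_def)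
  have pd: "positive_definite p \<Sigma>" using \<Sigma>(1) by (simp add: PD_dag_def)
  note \<Sigma>c = positive_definiteD(1,2)[OF pd]
  obtain x where x: "\<And>i j. j < i \<Longrightarrow> i < p \<Longrightarrow> \<Sigma> $$ (i, j) = (\<Sum>k\<in>parents E j. \<Sigma> $$ (i, k) * x j k)"
  proof -
    have "\<exists>x. \<forall>j<p. \<forall>i. j < i \<and> i < p \<longrightarrow> \<Sigma> $$ (i, j) = (\<Sum>k\<in>parents E j. \<Sigma> $$ (i, k) * x j k)"
      using \<Sigma>(1) unfolding PD_dag_iff[OF dag] by (intro choice) blast
    then show ?thesis
      using that by (meson less_trans)
  qed
  define L where "L = mat p p (\<lambda>(i, j). if i = j then 1 else if (i, j) \<in> E then - x j i else 0)"
  have "(i, j) \<notin> E" if "i < j" for i j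
    using ordered_dag_less[OF dag, of i j] that by auto
  moreover have "(i, i) \<in> E" if "i < p" for i
    using dag that by (simp add: ordered_dag_def)
  ultimately have L: "L \<in> unit_lower p E"
    by (auto simp: L_def unit_lower_def)
  have Lc: "L \<in> carrier_mat p p" by (simp add: L_def)
  obtain M where M: "M \<in> carrier_mat p p" "L * M = 1\<^sub>m p" "M * L = 1\<^sub>m p"
    using unit_lower_inverse[OF L] .
  have upper: "(\<Sigma> * L) $$ (i, j) = 0" if "j < i" "i < p" for i j
  proof -
    have "(\<Sum>k\<in>parents E j. \<Sigma> $$ (i, k) * L $$ (k, j)) = (\<Sum>k\<in>parents E j. - (\<Sigma> $$ (i, k) * x j k))"
      using ordered_dag_less[OF dag] by (intro sum.cong) (auto simp: L_def parents_def)
    then show ?thesis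
      using that mult_unit_lower_index[OF dag L \<Sigma>c(1), of i j] x[OF that] by (simp add: sum_negf)
  qed
  define D where "D = L\<^sup>T * \<Sigma> * L"
  have pdD: "positive_definite p D"
    unfolding D_def by (rule positive_definite_congruence[OF pd Lc]) (rule left_inverse_inj[OF M(1) Lc M(3)])
  note Dc = positive_definiteD(1,2)[OF pdD]
  have lower0: "D $$ (i, j) = 0" if "j < i" "i < p" for i j
  proof -
    have "D = L\<^sup>T * (\<Sigma> * L)"
      unfolding D_def using \<Sigma>c Lc by (simp add: assoc_mult_mat[of _ p p _ p _ p])
    then have "D $$ (i, j) = (\<Sum>k\<in>{0..<p}. L $$ (k, i) * (\<Sigma> * L) $$ (k, j))"
      using \<Sigma>c Lc that by (simp add: scalar_prod_def del: index_mult_mat(1)) (simp add: scalar_prod_def)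
    also have "\<dots> = 0"
    proof (rule sum.neutral, rule ballI)
      fix k assume "k \<in> {0..<p}"
      \<comment> \<open>For \<open>k < i\<close> the first factor vanishes; otherwise
        \<open>j < i \<le> k\<close> and the second one does.\<close>
      then show "L $$ (k, i) * (\<Sigma> * L) $$ (k, j) = 0"
        using upper[of j k] L that by (cases "k < i") (auto simp: unit_lower_def)
    qed
    finally show ?thesis .
  qed
  have D0: "D $$ (i, j) = 0" if "i \<noteq> j" "i < p" "j < p" for i j
  proof (cases "j < i")
    case False
    have "D $$ (i, j) = D\<^sup>T $$ (i, j)" by (simp add: Dc)
    then show ?thesis using lower0[of i j] False that Dc(1) by simp
  qed (use lower0 that in blast)
  define \<Lambda> where "\<Lambda> = mat p p (\<lambda>(i, j). if i = j then inverse (D $$ (i, i)) else 0)"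
  have \<Lambda>: "\<Lambda> \<in> carrier_mat p p" "diagonal_mat \<Lambda>"
    by (auto simp: \<Lambda>_def diagonal_mat_def)
  have "D * \<Lambda> = 1\<^sub>m p"
  proof (rule eq_matI)
    fix i j assume "i < dim_row (1\<^sub>m p :: real mat)" "j < dim_col (1\<^sub>m p :: real mat)"
    then have ij: "i < p" "j < p" by simp_all
    have "(D * \<Lambda>) $$ (i, j) = D $$ (i, j) * \<Lambda> $$ (j, j)"
      using Dc(1) \<Lambda> ij by (rule mult_diagonal_index)
    then show "(D * \<Lambda>) $$ (i, j) = 1\<^sub>m p $$ (i, j)"
      using ij D0[of i j] positive_definite_diag_pos[OF pdD, of j] by (auto simp: \<Lambda>_def)
  qed (use Dc \<Lambda> in auto)
  have MT: "M\<^sup>T * L\<^sup>T = 1\<^sub>m p"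
    using transpose_mult[OF Lc M(1)] unfolding M(2) transpose_one by metis
  \<comment> \<open>Inserting \<open>M\<^sup>T * L\<^sup>T\<close> on the left makes the factor
    \<open>D\<close> appear, which \<open>\<Lambda>\<close> cancels.\<close>
  have "\<Sigma> * (L * \<Lambda> * L\<^sup>T) = (M\<^sup>T * L\<^sup>T) * (\<Sigma> * (L * \<Lambda> * L\<^sup>T))"
    unfolding MT using \<Sigma>c(1) by simp
  also have "\<dots> = M\<^sup>T * ((D * \<Lambda>) * L\<^sup>T)"
    unfolding D_def using \<Sigma>c(1) Lc M(1) \<Lambda>(1) by (simp add: assoc_mult_mat[of _ p p _ p _ p])
  also have "\<dots> = 1\<^sub>m p"
    unfolding \<open>D * \<Lambda> = 1\<^sub>m p\<close> using MT Lc by simp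
  finally have inv: "\<Sigma> * (L * \<Lambda> * L\<^sup>T) = 1\<^sub>m p" .
  have "\<Omega> * \<Sigma> = 1\<^sub>m p"
    using \<Sigma>(2) mat_inverse_eq_Some_iff[OF \<Omega>c \<Sigma>c(1)] by simp
  then have "\<Sigma> * \<Omega> = 1\<^sub>m p"
    by (rule mat_mult_left_right_inverse[OF \<Omega>c \<Sigma>c(1)])
  \<comment> \<open>Both sides are the inverse of \<open>\<Sigma>\<close>.\<close>
  then have "\<Omega> = L * \<Lambda> * L\<^sup>T"
    using inv mat_inverse_eq_Some_iff[OF \<Sigma>c(1) \<Omega>c]
      mat_inverse_eq_Some_iff[OF \<Sigma>c(1), of "L * \<Lambda> * L\<^sup>T"] Lc \<Lambda>(1) by simp
  then show ?thesis
    using that L \<Lambda> by blast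
qed

theorem proposition3p2:
  fixes p :: nat and E :: "(nat \<times> nat) set"
  assumes "p \<ge> 1" and "ordered_dag p E"
  shows
    "(AE \<Gamma> in lebesgue_partial E. \<Gamma> (0, 0) \<noteq> 0 \<longrightarrow>
        (\<exists>!L\<Lambda>. cholesky_completion p E \<Gamma> (fst L\<Lambda>) (snd L\<Lambda>))) \<and>
     (\<forall>\<Gamma> \<in> partial_matrices E. \<forall>L \<Lambda>.
        \<Gamma> (0, 0) \<noteq> 0 \<and>
        (\<exists>!L\<Lambda>. cholesky_completion p E \<Gamma> (fst L\<Lambda>) (snd L\<Lambda>)) \<and>
        cholesky_completion p E \<Gamma> L \<Lambda> \<longrightarrow>
          ((pd_completion_in_P p E \<Gamma> (L * \<Lambda> * L\<^sup>T) \<and>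
            (\<forall>T. pd_completion_in_P p E \<Gamma> T \<longrightarrow> T = L * \<Lambda> * L\<^sup>T))
           \<longleftrightarrow> (\<forall>i<p. \<Lambda> $$ (i, i) > 0)))"
proof (intro conjI ballI allI impI; (elim conjE)?)
  show "AE \<Gamma> in lebesgue_partial E. \<Gamma> (0, 0) \<noteq> 0 \<longrightarrow>
        (\<exists>!L\<Lambda>. cholesky_completion p E \<Gamma> (fst L\<Lambda>) (snd L\<Lambda>))"
    using AE_lebesgue_partial_chol_diag_nonzero[OF assms(2)]
  proof eventually_elim
    case (elim \<Gamma>)
    show ?case
      unfolding cholesky_completion_iff_chol[OF assms(2) elim] by (auto simp: prod_eq_iff)
  qed
next
  fix \<Gamma> L \<Lambda>
  assume unique: "\<exists>!L\<Lambda>. cholesky_completion p E \<Gamma> (fst L\<Lambda>) (snd L\<Lambda>)"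
    and chol: "cholesky_completion p E \<Gamma> L \<Lambda>"
  then have L: "L \<in> unit_lower p E" and \<Lambda>: "\<Lambda> \<in> carrier_mat p p" "diagonal_mat \<Lambda>"
    and completion: "is_completion p E \<Gamma> (L * \<Lambda> * L\<^sup>T)"
    by (auto simp: cholesky_completion_def)
  \<comment> \<open>A competing completion in \<open>P_dag\<close> factors as well, so it yields a
    second Cholesky pair, which must coincide with the given one.\<close>
  have "T = L * \<Lambda> * L\<^sup>T" if T: "pd_completion_in_P p E \<Gamma> T" for T
  proof -
    obtain K \<Delta> where K: "K \<in> unit_lower p E" "\<Delta> \<in> carrier_mat p p" "diagonal_mat \<Delta>" "T = K * \<Delta> * K\<^sup>T"
      using P_dag_ldlE[OF assms(2)] T unfolding pd_completion_in_P_def by blast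
    then have "cholesky_completion p E \<Gamma> (fst (K, \<Delta>)) (snd (K, \<Delta>))"
      using T by (simp add: cholesky_completion_def pd_completion_in_P_def)
    moreover have "cholesky_completion p E \<Gamma> (fst (L, \<Lambda>)) (snd (L, \<Lambda>))"
      using chol by simp
    ultimately have "(K, \<Delta>) = (L, \<Lambda>)"
      using unique by blast
    then show ?thesis using K(4) by simp
  qed
  \<comment> \<open>Positive \<open>\<Lambda>\<close> gives positive definiteness and membership in
    \<open>P_dag\<close>; conversely, positive definiteness of the completion alone yields positive
    \<open>\<Lambda>\<close>.\<close>
  then show "(pd_completion_in_P p E \<Gamma> (L * \<Lambda> * L\<^sup>T) \<and>
            (\<forall>T. pd_completion_in_P p E \<Gamma> T \<longrightarrow> T = L * \<Lambda> * L\<^sup>T))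
           \<longleftrightarrow> (\<forall>i<p. \<Lambda> $$ (i, i) > 0)"
    using positive_definite_ldl_iff[OF L \<Lambda>] ldl_in_P_dag[OF assms(2) L \<Lambda>] completion
    unfolding pd_completion_in_P_def by blast
qed

end
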